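(* For every positive integer $m\geq 3$, there are absolute normalized and symmetric norms $\|\cdot\|$ on $\mathbb{R}^2$ such that the real Banach space $X=(\mathbb{R}^2,\|\cdot\|)$ satisfies $n^{(2m-1)}(X)=0$ and such that, for every positive number $\ell$, the function $(x,y)\longmapsto\|(x,y)\|^{2\ell}$ is not a polynomial on $\mathbb{R}^2$.
   Context: A norm $\|\cdot\|$ on $\mathbb{R}^2$ is absolute if $\|(x,y)\|=\|(|x|,|y|)\|$ for all $x,y\in\mathbb{R}$, normalized if $\|(1,0)\|=\|(0,1)\|=1$, and symmetric if $\|(x,y)\|=\|(y,x)\|$ for all $x,y\in\mathbb{R}$. For a Banach space $X$, let $S_X$ be its unit sphere, $B_X$ its closed unit ball, $X^*$ its dual, and $\Pi(X)=\{(x,x^* )\in S_X\times S_{X^*} : x^*(x)=1\}$. A continuous $k$-homogeneous polynomial on $X$ is a map $P:X\to X$ of the form $P(x)=A(x,\ldots,x)$ with $A:X\times\cdots\times X\to X$ a continuous $k$-linear map; $\mathcal{P}(^kX;X)$ is the space of all of them, normed by $\|P\|=\sup\{\|P(x)\| : x\in B_X\}$. The numerical radius of $P$ is $v(P)=\sup\{|x^*(P(x))| : (x,x^* )\in\Pi(X)\}$. The polynomial numerical index of order $k$ of $X$ is $n^{(k)}(X)=\inf\{v(P) : P\in\mathcal{P}(^kX;X),\ \|P\|=1\}$. *)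

theory Defs
  imports "HOL-Analysis.Analysis"
begin

text \<open>
  The norm is existentially quantified in the statement, so it cannot be the type-class norm. A
  normed space is a real vector space type together with a function \<open>N\<close> satisfying \<open>is_norm N\<close>; all
  metric notions below refer to \<open>N\<close>, never to the Euclidean norm of the type.
\<close>

definition is_norm :: "('a::real_vector \<Rightarrow> real) \<Rightarrow> bool" where
  "is_norm N \<longleftrightarrow>
     (\<forall>x. 0 \<le> N x) \<and>
     (\<forall>x. N x = 0 \<longleftrightarrow> x = 0) \<and>
     (\<forall>c x. N (c *\<^sub>R x) = \<bar>c\<bar> * N x) \<and>
     (\<forall>x y. N (x + y) \<le> N x + N y)"

definition absolute_norm :: "(real \<times> real \<Rightarrow> real) \<Rightarrow> bool" where
  "absolute_norm N \<longleftrightarrow> (\<forall>x y. N (x, y) = N (\<bar>x\<bar>, \<bar>y\<bar>))"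

definition normalized_norm :: "(real \<times> real \<Rightarrow> real) \<Rightarrow> bool" where
  "normalized_norm N \<longleftrightarrow> N (1, 0) = 1 \<and> N (0, 1) = 1"

definition symmetric_norm :: "(real \<times> real \<Rightarrow> real) \<Rightarrow> bool" where
  "symmetric_norm N \<longleftrightarrow> (\<forall>x y. N (x, y) = N (y, x))"

definition norm_topology :: "('a::real_vector \<Rightarrow> real) \<Rightarrow> 'a topology" where
  "norm_topology N = Metric_space.mtopology UNIV (\<lambda>x y. N (x - y))"

text \<open>
  Real \<open>Sup\<close> and \<open>Inf\<close> are meaningful only for nonempty sets that are bounded on the relevant side.
  For a norm on a nonzero space this holds in the definitions below: the suprema are finite by
  continuity of \<open>f\<close> and \<open>P\<close>, and the infimum is over nonnegative numbers.
\<close>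

definition dual_norm :: "('a::real_vector \<Rightarrow> real) \<Rightarrow> ('a \<Rightarrow> real) \<Rightarrow> real" where
  "dual_norm N f = Sup {\<bar>f x\<bar> |x. N x \<le> 1}"

definition dual_space :: "('a::real_vector \<Rightarrow> real) \<Rightarrow> ('a \<Rightarrow> real) set" where
  "dual_space N = {f. linear f \<and> continuous_map (norm_topology N) euclideanreal f}"

definition state_pairs :: "('a::real_vector \<Rightarrow> real) \<Rightarrow> ('a \<times> ('a \<Rightarrow> real)) set" where
  "state_pairs N = {(x, f). N x = 1 \<and> f \<in> dual_space N \<and> dual_norm N f = 1 \<and> f x = 1}"

text \<open>
  A \<open>k\<close>-tuple is an extensional function on \<open>{..<k}\<close>, i.e. a point of the product topology.
\<close>

definition k_linear :: "nat \<Rightarrow> ((nat \<Rightarrow> 'a::real_vector) \<Rightarrow> 'a) \<Rightarrow> bool" where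
  "k_linear k A \<longleftrightarrow>
     (\<forall>x \<in> {..<k} \<rightarrow>\<^sub>E UNIV. \<forall>i<k. linear (\<lambda>v. A (x(i := v))))"

definition homogeneous_polynomials ::
    "nat \<Rightarrow> ('a::real_vector \<Rightarrow> real) \<Rightarrow> ('a \<Rightarrow> 'a) set" where
  "homogeneous_polynomials k N =
     {P. \<exists>A. k_linear k A \<and>
             continuous_map (product_topology (\<lambda>_. norm_topology N) {..<k}) (norm_topology N) A \<and>
             (\<forall>x. P x = A (restrict (\<lambda>_. x) {..<k}))}"

definition polynomial_norm :: "('a::real_vector \<Rightarrow> real) \<Rightarrow> ('a \<Rightarrow> 'a) \<Rightarrow> real" where
  "polynomial_norm N P = Sup {N (P x) |x. N x \<le> 1}"

definition numerical_radius :: "('a::real_vector \<Rightarrow> real) \<Rightarrow> ('a \<Rightarrow> 'a) \<Rightarrow> real" where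
  "numerical_radius N P = Sup {\<bar>f (P x)\<bar> |x f. (x, f) \<in> state_pairs N}"

definition polynomial_numerical_index :: "nat \<Rightarrow> ('a::real_vector \<Rightarrow> real) \<Rightarrow> real" where
  "polynomial_numerical_index k N =
     Inf {numerical_radius N P |P. P \<in> homogeneous_polynomials k N \<and> polynomial_norm N P = 1}"

end

theory Submission
  imports Defs "HOL-Computational_Algebra.Polynomial"
begin

text \<open>
  The norm is given by \<open>N(x,y)\<^sup>2 = q/s\<close> with \<open>s = x\<^sup>2 + y\<^sup>2\<close> and \<open>q = x\<^sup>4 + 3x\<^sup>2y\<^sup>2 + y\<^sup>4\<close>. Up to a factor,
  the gradient of \<open>N\<^sup>2\<close> is a vector field with homogeneous polynomial components of degree 5.
  Rotating it by a right angle and multiplying by \<open>s\<^bsup>m-3\<^esup>\<close> gives a homogeneous polynomial of degree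
  \<open>2m - 1\<close> tangent to the unit sphere; its numerical radius vanishes, because a norming functional
  at a point of differentiability annihilates the tangent vectors there.

  If \<open>N\<^bsup>2l\<^esup>\<close> were a polynomial, then \<open>2l\<close> would be a natural number \<open>n\<close>, by homogeneity on the first
  axis. Squaring on the line \<open>y = 1\<close> gives \<open>r\<^sup>2 s\<^sup>n = q\<^sup>n\<close> for a polynomial \<open>r\<close>, which is impossible
  because \<open>q = s(s + 1) - 1\<close> is coprime to \<open>s\<close>.
\<close>

section \<open>Norms comparable with the Euclidean norm: topology, functionals, compact
  balls\<close>

text \<open>Either kind of ball contains a rescaled ball of the other kind with the same centre.
  This replaces the topology generated by \<open>N\<close>, in which all continuity requirements are
  phrased, by the usual one.\<close>

lemma norm_topology_eq_euclidean:
  fixes N :: "'a::real_normed_vector \<Rightarrow> real"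
  assumes "is_norm N" and "c > 0" and lower: "\<And>v. c * norm v \<le> N v"
    and "C > 0" and upper: "\<And>v. N v \<le> C * norm v"
  shows "norm_topology N = euclidean"
proof -
  have N0: "N x = 0 \<longleftrightarrow> x = 0" and Nnn: "0 \<le> N x" and Nsc: "N (a *\<^sub>R x) = \<bar>a\<bar> * N x"
    and Ntri: "N (x + y) \<le> N x + N y" for a x y
    using assms(1) unfolding is_norm_def by auto
  have Nsym: "N (x - y) = N (y - x)" for x y
    using Nsc[of "-1" "x - y"] by simp
  interpret M: Metric_space UNIV "\<lambda>x y. N (x - y)"
  proof
    show "N (x - z) \<le> N (x - y) + N (y - z)" for x y z
      using Ntri[of "x - y" "y - z"] by simp
  qed (auto simp: N0 Nnn Nsym)
  have "openin M.mtopology U \<longleftrightarrow> open U" for U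
  proof
    assume U: "openin M.mtopology U"
    show "open U"
    proof (rule openI)
      fix x assume "x \<in> U"
      then obtain r where r: "r > 0" "M.mball x r \<subseteq> U"
        using U unfolding M.openin_mtopology by blast
      have "ball x (r / C) \<subseteq> M.mball x r"
      proof
        fix y assume "y \<in> ball x (r / C)"
        then have "C * norm (x - y) < r"
          using \<open>C > 0\<close> by (simp add: dist_norm field_simps)
        then show "y \<in> M.mball x r"
          using upper[of "x - y"] by simp
      qed
      then show "\<exists>e>0. ball x e \<subseteq> U"
        using r \<open>C > 0\<close> by (intro exI[of _ "r / C"]) auto
    qed
  next
    assume U: "open U"
    show "openin M.mtopology U"
      unfolding M.openin_mtopology
    proof (intro conjI allI impI)
      fix x assume "x \<in> U"
      then obtain r where r: "r > 0" "ball x r \<subseteq> U"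
        using U open_contains_ball by blast
      have "M.mball x (c * r) \<subseteq> ball x r"
      proof
        fix y assume "y \<in> M.mball x (c * r)"
        then have "c * norm (x - y) < c * r"
          using lower[of "x - y"] by simp
        then show "y \<in> ball x r"
          using \<open>c > 0\<close> by (simp add: dist_norm)
      qed
      then show "\<exists>r>0. M.mball x r \<subseteq> U"
        using r \<open>c > 0\<close> by (intro exI[of _ "c * r"]) auto
    qed simp
  qed
  then show ?thesis
    unfolding norm_topology_def by (simp add: topology_eq)
qed

lemma state_pairs_abs_le:
  fixes N :: "'a::euclidean_space \<Rightarrow> real"
  assumes "is_norm N" and "c > 0" and lower: "\<And>v. c * norm v \<le> N v"
    and xf: "(x, f) \<in> state_pairs N"
  shows "\<bar>f v\<bar> \<le> N v"
proof (cases "v = 0")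
  case True
  then show ?thesis
    using xf assms(1) linear_0[of f] by (auto simp: state_pairs_def dual_space_def is_norm_def)
next
  case False
  have lin: "linear f" and dn: "Sup {\<bar>f x\<bar> |x. N x \<le> 1} = 1"
    using xf by (auto simp: state_pairs_def dual_space_def dual_norm_def)
  obtain K where K: "K > 0" "\<And>v. \<bar>f v\<bar> \<le> norm v * K"
    using bounded_linear.pos_bounded[of f] lin linear_conv_bounded_linear[of f] by auto
  \<comment> \<open>The real \<open>Sup\<close> bounds its members only once the set is known to be
    bounded. In finite dimension \<open>f\<close> is bounded for the Euclidean norm, and
    \<open>lower\<close> keeps the \<open>N\<close>-ball inside a Euclidean ball of radius
    \<open>1 / c\<close>.\<close>
  have "bdd_above {\<bar>f x\<bar> |x. N x \<le> 1}"
  proof (rule bdd_aboveI, clarify)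
    fix y assume "N y \<le> 1"
    then have "norm y \<le> 1 / c"
      using lower[of y] \<open>c > 0\<close> by (simp add: field_simps)
    then show "\<bar>f y\<bar> \<le> 1 / c * K"
      using K(2)[of y] mult_right_mono[of "norm y" "1 / c" K] K(1) by linarith
  qed
  moreover have Nv: "N v > 0"
    using False assms(1) by (auto simp: is_norm_def order_less_le)
  then have "N ((1 / N v) *\<^sub>R v) \<le> 1"
    using assms(1) by (simp add: is_norm_def)
  ultimately have "\<bar>f ((1 / N v) *\<^sub>R v)\<bar> \<le> Sup {\<bar>f x\<bar> |x. N x \<le> 1}"
    by (intro cSup_upper) auto
  then show ?thesis
    using Nv dn by (simp add: linear_scale[OF lin] abs_mult field_simps)
qed

lemma homogeneous_polynomials_continuous:
  fixes N :: "'a::real_normed_vector \<Rightarrow> real"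
  assumes top: "norm_topology N = euclidean" and P: "P \<in> homogeneous_polynomials k N"
  shows "continuous_on UNIV P"
proof -
  obtain A where A: "continuous_map (product_topology (\<lambda>_. euclidean) {..<k}) euclidean A"
    and PA: "P = A \<circ> (\<lambda>x. restrict (\<lambda>_. x) {..<k})"
    using P unfolding homogeneous_polynomials_def top by (auto simp: fun_eq_iff)
  have "continuous_map euclidean (product_topology (\<lambda>_. euclidean) {..<k})
          (\<lambda>x::'a. restrict (\<lambda>_. x) {..<k})"
    unfolding continuous_map_componentwise by (auto simp: id_def[symmetric])
  then show ?thesis
    unfolding PA using A by (metis continuous_map_compose continuous_map_iff_continuous2)
qed

lemma compact_norm_ball:
  fixes N :: "'a::euclidean_space \<Rightarrow> real"
  assumes "c > 0" and lower: "\<And>v. c * norm v \<le> N v" and cont: "continuous_on UNIV N"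
  shows "compact {x. N x \<le> 1}"
unfolding compact_eq_bounded_closed
proof
  show "bounded {x. N x \<le> 1}"
  proof (rule boundedI, clarify)
    fix x assume "N x \<le> 1"
    then show "norm x \<le> 1 / c"
      using lower[of x] \<open>c > 0\<close> by (simp add: field_simps)
  qed
  show "closed {x. N x \<le> 1}"
    using cont by (intro closed_Collect_le continuous_on_const)
qed

section \<open>Numerical radius and a criterion for a vanishing index\<close>

text \<open>Nonnegativity is not automatic for a real \<open>Sup\<close>: the set of values has to
  be nonempty and bounded. A state comes from \<open>ne\<close>, and the bound from compactness of
  the \<open>N\<close>-ball and continuity of \<open>P\<close>.\<close>

lemma numerical_radius_nonneg:
  fixes N :: "'a::euclidean_space \<Rightarrow> real"
  assumes "is_norm N" and "c > 0" and lower: "\<And>v. c * norm v \<le> N v"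
    and cont: "continuous_on UNIV N" and "norm_topology N = euclidean"
    and ne: "state_pairs N \<noteq> {}" and P: "P \<in> homogeneous_polynomials k N"
  shows "0 \<le> numerical_radius N P"
proof -
  have "continuous_on UNIV (\<lambda>x. N (P x))"
    using continuous_on_compose2[OF cont homogeneous_polynomials_continuous[OF assms(5) P]] by simp
  then have "compact ((\<lambda>x. N (P x)) ` {x. N x \<le> 1})"
    using compact_norm_ball[OF assms(2,3) cont]
    by (meson compact_continuous_image continuous_on_subset subset_UNIV)
  then obtain B where B: "\<And>x. N x \<le> 1 \<Longrightarrow> N (P x) \<le> B"
    using compact_imp_bounded bounded_imp_bdd_above by (fastforce simp: bdd_above_def)
  have "bdd_above {\<bar>f (P x)\<bar> |x f. (x, f) \<in> state_pairs N}"
  proof (rule bdd_aboveI, clarify)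
    fix x f assume xf: "(x, f) \<in> state_pairs N"
    then have "N x \<le> 1"
      by (simp add: state_pairs_def)
    then show "\<bar>f (P x)\<bar> \<le> B"
      using B state_pairs_abs_le[OF assms(1-3) xf, of "P x"] by force
  qed
  moreover obtain x f where "(x, f) \<in> state_pairs N"
    using ne by auto
  ultimately have "\<bar>f (P x)\<bar> \<le> numerical_radius N P"
    unfolding numerical_radius_def by (intro cSup_upper) auto
  then show ?thesis
    by linarith
qed

text \<open>Dividing \<open>P\<close> by the largest value of \<open>N (P x)\<close> on the ball
  gives a competitor of norm 1 and numerical radius 0, so the infimum of nonnegative numbers is
  attained. The point \<open>z\<close> guarantees that the divisor is positive.\<close>

lemma polynomial_numerical_index_eq_0:
  fixes N :: "'a::euclidean_space \<Rightarrow> real"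
  assumes "is_norm N" and "c > 0" and lower: "\<And>v. c * norm v \<le> N v"
    and cont: "continuous_on UNIV N" and top: "norm_topology N = euclidean"
    and ne: "state_pairs N \<noteq> {}"
    and P: "\<And>a. (\<lambda>x. a *\<^sub>R P x) \<in> homogeneous_polynomials k N" and z: "P z \<noteq> 0" "N z \<le> 1"
    and tangent: "\<And>x f. (x, f) \<in> state_pairs N \<Longrightarrow> f (P x) = 0"
  shows "polynomial_numerical_index k N = 0"
proof -
  have Nsc: "N (a *\<^sub>R x) = \<bar>a\<bar> * N x" and N0: "N x = 0 \<longleftrightarrow> x = 0" and Nnn: "0 \<le> N x" for a x
    using assms(1) by (auto simp: is_norm_def)
  have "continuous_on UNIV P"
    using homogeneous_polynomials_continuous[OF top P[of 1]] by simp
  then have contP: "continuous_on UNIV (\<lambda>x. N (P x))"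
    using continuous_on_compose2[OF cont] by simp
  have "{x. N x \<le> 1} \<noteq> {}"
    using z by auto
  then obtain x\<^sub>0 where x0: "N x\<^sub>0 \<le> 1" and max: "\<And>x. N x \<le> 1 \<Longrightarrow> N (P x) \<le> N (P x\<^sub>0)"
    using continuous_attains_sup[OF compact_norm_ball[OF assms(2,3) cont],
        of "\<lambda>x. N (P x)"] continuous_on_subset[OF contP subset_UNIV] by auto
  define M where "M = N (P x\<^sub>0)"
  have "0 < N (P z)"
    using z N0 Nnn by (simp add: order_less_le)
  then have M: "M > 0"
    using max[OF z(2)] by (simp add: M_def)
  define Q where "Q = (\<lambda>x. (1 / M) *\<^sub>R P x)"
  have "Sup {N (Q x) |x. N x \<le> 1} = 1"
  proof (rule cSup_eq_maximum)
    show "1 \<in> {N (Q x) |x. N x \<le> 1}"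
      using x0 M by (auto simp: Q_def Nsc M_def intro!: exI[of _ x\<^sub>0])
    show "y \<le> 1" if "y \<in> {N (Q x) |x. N x \<le> 1}" for y
      using that M max by (auto simp: Q_def Nsc M_def)
  qed
  then have "polynomial_norm N Q = 1"
    by (simp add: polynomial_norm_def)
  moreover have "numerical_radius N Q = 0"
  proof -
    have "f (Q x) = 0" if "(x, f) \<in> state_pairs N" for x f
    proof -
      have "linear f"
        using that by (simp add: state_pairs_def dual_space_def)
      then show ?thesis
        using tangent[OF that] by (simp add: Q_def linear_scale)
    qed
    \<comment> \<open>A state exists, so this is not the empty set, whose \<open>Sup\<close> would
      carry no information.\<close>
    then have "{\<bar>f (Q x)\<bar> |x f. (x, f) \<in> state_pairs N} = {0}"
      using ne by fastforce
    then show ?thesis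
      by (simp add: numerical_radius_def)
  qed
  moreover have "Q \<in> homogeneous_polynomials k N"
    using P by (simp add: Q_def)
  ultimately show ?thesis
    unfolding polynomial_numerical_index_def
    using numerical_radius_nonneg[OF assms(1-3) cont top ne]
    by (intro cInf_eq_minimum) (auto intro!: exI[of _ Q])
qed

section \<open>A quartic quotient as the square of a norm\<close>

text \<open>In this form the quotient \<open>q / s\<close> is visibly at least \<open>s\<close>. At
  the origin the convention for division by zero gives the right value 0.\<close>

definition quartic_norm_sq :: "real \<times> real \<Rightarrow> real" where
  "quartic_norm_sq p = (case p of (x, y) \<Rightarrow> x\<^sup>2 + y\<^sup>2 + x\<^sup>2 * y\<^sup>2 / (x\<^sup>2 + y\<^sup>2))"

definition quartic_norm :: "real \<times> real \<Rightarrow> real" where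
  "quartic_norm p = sqrt (quartic_norm_sq p)"

definition tangent_field :: "real \<times> real \<Rightarrow> real \<times> real" where
  "tangent_field p = (case p of (x, y) \<Rightarrow>
     (- (y * (y^4 + 2 * x\<^sup>2 * y\<^sup>2 + 2 * x^4)), x * (x^4 + 2 * x\<^sup>2 * y\<^sup>2 + 2 * y^4)))"

text \<open>Half the derivative of \<^term>\<open>quartic_norm_sq\<close> at \<open>w\<close> in direction \<open>v\<close>.\<close>

definition support_form :: "real \<times> real \<Rightarrow> real \<times> real \<Rightarrow> real" where
  "support_form w v = (case (w, v) of ((x, y), (a, b)) \<Rightarrow>
     (x * (x^4 + 2 * x\<^sup>2 * y\<^sup>2 + 2 * y^4) * a + y * (y^4 + 2 * x\<^sup>2 * y\<^sup>2 + 2 * x^4) * b)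
       / (x\<^sup>2 + y\<^sup>2)\<^sup>2)"

lemma quartic_norm_sq_eq_quotient:
  "quartic_norm_sq (x, y) = (x^4 + 3 * x\<^sup>2 * y\<^sup>2 + y^4) / (x\<^sup>2 + y\<^sup>2)"
proof (cases "x\<^sup>2 + y\<^sup>2 = 0")
  case True
  then have "x = 0" "y = 0" by (simp_all add: sum_power2_eq_zero_iff)
  then show ?thesis by (simp add: quartic_norm_sq_def)
next
  case False
  then show ?thesis
    by (simp add: quartic_norm_sq_def field_simps)
qed

text \<open>Euler's identity for a function homogeneous of degree 2: its derivative at
  \<open>w\<close> in direction \<open>w\<close> is twice its value.\<close>

lemma support_form_self: "support_form w w = quartic_norm_sq w"
proof (cases w)
  case (Pair x y)
  show ?thesis
  proof (cases "x\<^sup>2 + y\<^sup>2 = 0")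
    case True
    then show ?thesis by (simp add: Pair support_form_def quartic_norm_sq_eq_quotient)
  next
    case False
    have "x * (x^4 + 2 * x\<^sup>2 * y\<^sup>2 + 2 * y^4) * x + y * (y^4 + 2 * x\<^sup>2 * y\<^sup>2 + 2 * x^4) * y
        = (x^4 + 3 * x\<^sup>2 * y\<^sup>2 + y^4) * (x\<^sup>2 + y\<^sup>2)"
      by algebra
    then show ?thesis
      using False unfolding Pair support_form_def quartic_norm_sq_eq_quotient
      by (simp add: power2_eq_square)
  qed
qed

lemma support_form_add: "support_form w (u + v) = support_form w u + support_form w v"
  by (cases w; cases u; cases v) (simp add: support_form_def algebra_simps add_divide_distrib[symmetric])

lemma quartic_norm_sq_nonneg: "0 \<le> quartic_norm_sq p"
  by (cases p) (simp add: quartic_norm_sq_def)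

lemma quartic_norm_sq_bounds:
  "(norm p)\<^sup>2 \<le> quartic_norm_sq p" "quartic_norm_sq p \<le> (2 * norm p)\<^sup>2"
proof -
  obtain x y where p: "p = (x, y)" by force
  have n: "(norm p)\<^sup>2 = x\<^sup>2 + y\<^sup>2"
    by (simp add: p norm_Pair)
  show "(norm p)\<^sup>2 \<le> quartic_norm_sq p"
    unfolding n by (simp add: p quartic_norm_sq_def)
  have "x\<^sup>2 * y\<^sup>2 / (x\<^sup>2 + y\<^sup>2) \<le> x\<^sup>2 + y\<^sup>2"
  proof (cases "x\<^sup>2 + y\<^sup>2 = 0")
    case False
    then have "x\<^sup>2 + y\<^sup>2 > 0"
      by (simp add: order_less_le)
    then show ?thesis
      by (simp add: pos_divide_le_eq algebra_simps)
  qed simp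
  \<comment> \<open>The bound to reach is 4 (x^2 + y^2), and one summand x^2 + y^2 already stands in
    the definition.\<close>
  then have "x\<^sup>2 * y\<^sup>2 / (x\<^sup>2 + y\<^sup>2) \<le> 3 * (x\<^sup>2 + y\<^sup>2)"
    by (rule order_trans) simp
  then show "quartic_norm_sq p \<le> (2 * norm p)\<^sup>2"
    unfolding n power_mult_distrib by (auto simp: p quartic_norm_sq_def intro: order_trans)
qed

text \<open>
  With \<open>\<phi>\<close> the angle from \<open>w\<close> to \<open>v\<close>, the defect \<open>N(w)\<^sup>2N(v)\<^sup>2 - support_form(w,v)\<^sup>2\<close> vanishes to second
  order at \<open>\<phi> = 0\<close>, so \<open>e\<^sup>2\<close> with \<open>e = |w||v| sin \<phi>\<close> splits off. In complex notation the remaining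
  factor \<open>R\<close> involves \<open>d = Re(conj(w) v)\<close> and \<open>h = Re(w\<^sup>3v)\<close>, which Cauchy-Schwarz controls.
\<close>

lemma support_form_le:
  "support_form w v \<le> quartic_norm w * quartic_norm v"
proof -
  obtain x y a b where w: "w = (x, y)" and v: "v = (a, b)" by (metis surj_pair)
  define s q d e where "s = x\<^sup>2 + y\<^sup>2" and "q = x^4 + 3 * x\<^sup>2 * y\<^sup>2 + y^4"
    and "d = x * a + y * b" and "e = x * b - y * a"
  define s' q' where "s' = a\<^sup>2 + b\<^sup>2" and "q' = a^4 + 3 * a\<^sup>2 * b\<^sup>2 + b^4"
  define C where "C = x * (x^4 + 2 * x\<^sup>2 * y\<^sup>2 + 2 * y^4) * a + y * (y^4 + 2 * x\<^sup>2 * y\<^sup>2 + 2 * x^4) * b"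
  define h where "h = (x^3 - 3 * x * y\<^sup>2) * a - (3 * x\<^sup>2 * y - y^3) * b"
  define R where "R = s' * (q\<^sup>2 - x\<^sup>2 * y\<^sup>2 * (x\<^sup>2 - y\<^sup>2)\<^sup>2) + q * (d * h)"
  show ?thesis
  proof (cases "s = 0 \<or> s' = 0")
    case True
    then have "w = 0 \<or> v = 0"
      by (auto simp: s_def s'_def w v sum_power2_eq_zero_iff zero_prod_def)
    then show ?thesis
      by (auto simp: w v quartic_norm_def quartic_norm_sq_def support_form_def zero_prod_def)
  next
    case False
    then have pos: "s > 0" "s' > 0"
      by (simp_all add: s_def s'_def order_less_le)
    have q: "q = s\<^sup>2 + x\<^sup>2 * y\<^sup>2"
      unfolding q_def s_def by algebra
    \<comment> \<open>Two sums of two squares: with \<open>w\<close> and \<open>v\<close> read as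
      complex numbers, |w|^2 |v|^2 = d^2 + e^2, and |w^3 v|^2 is h^2 plus the square of the
      imaginary part.\<close>
    have "(d * h)\<^sup>2 \<le> (s\<^sup>2 * s')\<^sup>2"
    proof -
      have "(s\<^sup>2 * s')\<^sup>2 = s * s' * (s^3 * s')" by algebra
      moreover have "s * s' = d\<^sup>2 + e\<^sup>2"
        unfolding s_def s'_def d_def e_def by algebra
      moreover have "s^3 * s' = h\<^sup>2 + ((x^3 - 3 * x * y\<^sup>2) * b + (3 * x\<^sup>2 * y - y^3) * a)\<^sup>2"
        unfolding s_def s'_def h_def by algebra
      ultimately show ?thesis
        by (simp add: power_mult_distrib mult_mono)
    qed
    then have "\<bar>d * h\<bar> \<le> s\<^sup>2 * s'"
      using pos by (simp add: abs_le_square_iff[symmetric])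
    then have dh: "- (s\<^sup>2 * s') \<le> d * h" by linarith
    have qpos: "q \<ge> 0" by (simp add: q)
    \<comment> \<open>Since q = s^2 + x^2 y^2, even the worst case d h = - s^2 s' leaves the
      nonnegative remainder 5 s' x^4 y^4.\<close>
    have "R \<ge> s' * (q\<^sup>2 - x\<^sup>2 * y\<^sup>2 * (x\<^sup>2 - y\<^sup>2)\<^sup>2) + q * (- (s\<^sup>2 * s'))"
      unfolding R_def using mult_left_mono[OF dh qpos] by linarith
    also have "s' * (q\<^sup>2 - x\<^sup>2 * y\<^sup>2 * (x\<^sup>2 - y\<^sup>2)\<^sup>2) + q * (- (s\<^sup>2 * s'))
        = s' * (x\<^sup>2 * y\<^sup>2 * (5 * x\<^sup>2 * y\<^sup>2))"
      unfolding q_def s_def by algebra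
    finally have "R \<ge> 0"
      using pos by (smt (verit) mult_nonneg_nonneg zero_le_power2 mult.assoc)
    moreover have "q * q' * s^3 - C\<^sup>2 * s' = e\<^sup>2 * R"
      unfolding R_def C_def h_def q_def q'_def s_def s'_def d_def e_def by algebra
    ultimately have "C\<^sup>2 * s' \<le> q * q' * s^3"
      by (metis diff_ge_0_iff_ge mult_nonneg_nonneg zero_le_power2)
    then have "(C / s\<^sup>2)\<^sup>2 \<le> (q / s) * (q' / s')"
      using pos by (simp add: field_simps power_numeral_reduce)
    then have "(support_form w v)\<^sup>2 \<le> quartic_norm_sq w * quartic_norm_sq v"
      by (simp add: w v support_form_def quartic_norm_sq_eq_quotient C_def s_def q_def s'_def q'_def)
    then show ?thesis
      unfolding quartic_norm_def real_sqrt_mult[symmetric] by (rule real_le_rsqrt)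
  qed
qed

lemma is_norm_quartic_norm: "is_norm quartic_norm"
  unfolding is_norm_def
proof (intro conjI allI)
  fix c :: real and u v :: "real \<times> real"
  show "0 \<le> quartic_norm u"
    by (simp add: quartic_norm_def quartic_norm_sq_nonneg)
  show "quartic_norm u = 0 \<longleftrightarrow> u = 0"
    using quartic_norm_sq_bounds(1)[of u] quartic_norm_sq_bounds(2)[of u]
    by (auto simp: quartic_norm_def)
  show "quartic_norm (c *\<^sub>R u) = \<bar>c\<bar> * quartic_norm u"
  proof -
    have "quartic_norm_sq (c *\<^sub>R u) = c\<^sup>2 * quartic_norm_sq u"
    proof (cases u, cases "c = 0")
      fix x y assume u: "u = (x, y)" and c: "c \<noteq> 0"
      have "(c * x)\<^sup>2 * (c * y)\<^sup>2 / ((c * x)\<^sup>2 + (c * y)\<^sup>2)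
          = (c\<^sup>2 * (c\<^sup>2 * (x\<^sup>2 * y\<^sup>2))) / (c\<^sup>2 * (x\<^sup>2 + y\<^sup>2))"
        by (simp only: power_mult_distrib distrib_left mult.assoc mult.left_commute)
      also have "\<dots> = c\<^sup>2 * (x\<^sup>2 * y\<^sup>2) / (x\<^sup>2 + y\<^sup>2)"
        using c by (intro mult_divide_mult_cancel_left) simp
      finally show ?thesis
        by (simp add: u quartic_norm_sq_def power_mult_distrib distrib_left)
    qed (simp add: quartic_norm_sq_def)
    then show ?thesis
      by (simp add: quartic_norm_def real_sqrt_mult)
  qed
  show "quartic_norm (u + v) \<le> quartic_norm u + quartic_norm v"
  proof (cases "quartic_norm (u + v) > 0")
    case False
    moreover have "0 \<le> quartic_norm u" "0 \<le> quartic_norm v"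
      by (simp_all add: quartic_norm_def quartic_norm_sq_nonneg)
    ultimately show ?thesis
      by linarith
  next
    case True
    \<comment> \<open>Additivity in the second argument splits the squared norm of
      \<open>u + v\<close> into two terms, each bounded by \<open>support_form_le\<close>; one
      factor \<open>quartic_norm (u + v)\<close> is then cancelled.\<close>
    have "quartic_norm (u + v) * quartic_norm (u + v) = support_form (u + v) (u + v)"
      by (simp add: support_form_self quartic_norm_def quartic_norm_sq_nonneg)
    also have "\<dots> \<le> quartic_norm (u + v) * (quartic_norm u + quartic_norm v)"
      using support_form_le[of "u + v" u] support_form_le[of "u + v" v]
      by (simp add: support_form_add distrib_left)
    finally show ?thesis
      using True by (simp only: mult_le_cancel_left_pos)
  qed
qed

section \<open>Euclidean comparison, continuity and existence of states for the quartic norm\<close>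

lemma norm_le_quartic_norm: "norm p \<le> quartic_norm p"
  unfolding quartic_norm_def by (intro real_le_rsqrt quartic_norm_sq_bounds)

lemma quartic_norm_le_norm: "quartic_norm p \<le> 2 * norm p"
  unfolding quartic_norm_def by (intro real_le_lsqrt quartic_norm_sq_bounds quartic_norm_sq_nonneg) auto

lemma continuous_on_quartic_norm: "continuous_on UNIV quartic_norm"
proof -
  have tri: "quartic_norm (x + y) \<le> quartic_norm x + quartic_norm y" for x y
    using is_norm_quartic_norm unfolding is_norm_def by blast
  have "quartic_norm x - quartic_norm y \<le> 2 * norm (x - y)" for x y
    using tri[of "x - y" y] quartic_norm_le_norm[of "x - y"] by simp
  then have "dist (quartic_norm x) (quartic_norm y) \<le> 2 * dist x y" for x y
    by (smt (verit) dist_norm dist_commute real_norm_def)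
  then have "2-lipschitz_on UNIV quartic_norm"
    by (auto intro: lipschitz_onI)
  then show ?thesis
    by (rule lipschitz_on_continuous_on)
qed

lemma norm_topology_quartic_norm: "norm_topology quartic_norm = euclidean"
  by (rule norm_topology_eq_euclidean[OF is_norm_quartic_norm, of 1 2])
     (simp_all add: norm_le_quartic_norm quartic_norm_le_norm)

text \<open>The first coordinate is a norming functional at (1, 0), because |x| is at most the
  Euclidean norm and hence at most \<open>quartic_norm\<close>. Such a state keeps the set of values
  defining the numerical radius nonempty.\<close>

lemma state_pairs_quartic_norm_ne: "state_pairs quartic_norm \<noteq> {}"
proof -
  have N1: "quartic_norm (1, 0) = 1"
    by (simp add: quartic_norm_def quartic_norm_sq_def)
  have le: "\<bar>fst v\<bar> \<le> quartic_norm v" for v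
    using norm_fst_le[of "fst v" "snd v"] norm_le_quartic_norm[of v] by simp
  have "dual_norm quartic_norm fst = 1"
    unfolding dual_norm_def
  proof (rule cSup_eq_maximum)
    show "1 \<in> {\<bar>fst x\<bar> |x. quartic_norm x \<le> 1}"
      using N1 by (intro CollectI exI[of _ "(1, 0)"]) auto
    show "y \<le> 1" if "y \<in> {\<bar>fst x\<bar> |x. quartic_norm x \<le> 1}" for y
      using that order_trans[OF le] by auto
  qed
  moreover have "fst \<in> dual_space quartic_norm"
    by (simp add: dual_space_def norm_topology_quartic_norm bounded_linear.linear[OF bounded_linear_fst] continuous_on_fst)
  ultimately have "((1, 0), fst) \<in> state_pairs quartic_norm"
    using N1 by (simp add: state_pairs_def)
  then show ?thesis by auto
qed

section \<open>Norming functionals on tangent vectors\<close>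

text \<open>Along the line through \<open>p\<close> in the direction of the field, the squared norm
  minus the square of \<open>f\<close> is nonnegative and vanishes at \<open>p\<close>, so its
  derivative there is 0. The field is tangent to the level curve of the norm, so that derivative is
  -2 times \<open>f (tangent_field p)\<close>.\<close>

lemma state_annihilates_tangent_field:
  assumes le: "\<And>v. \<bar>f v\<bar> \<le> quartic_norm v" and "linear f" "f p = 1" "quartic_norm p = 1"
  shows "f (tangent_field p) = 0"
proof -
  obtain x y a b where p: "p = (x, y)" and t: "tangent_field p = (a, b)" by (metis surj_pair)
  define g where "g = (\<lambda>t. quartic_norm_sq (x + t * a, y + t * b) - (1 + t * f (a, b))\<^sup>2)"
  have s: "x\<^sup>2 + y\<^sup>2 \<noteq> 0"
    using assms(4) by (auto simp: p quartic_norm_def quartic_norm_sq_def)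
  have g0: "g 0 = 0"
    using assms(4) by (simp add: g_def p quartic_norm_def)
  have "g t \<ge> 0" for t
  proof -
    have "(x + t * a, y + t * b) = p + t *\<^sub>R (a, b)"
      by (simp add: p)
    then have "f (x + t * a, y + t * b) = 1 + t * f (a, b)"
      using \<open>linear f\<close> \<open>f p = 1\<close> by (simp only: linear_add linear_scale real_scaleR_def)
    then have "\<bar>1 + t * f (a, b)\<bar>\<^sup>2 \<le> (quartic_norm (x + t * a, y + t * b))\<^sup>2"
      using le[of "(x + t * a, y + t * b)"] by (intro power_mono) auto
    then show ?thesis
      by (simp add: g_def quartic_norm_def quartic_norm_sq_nonneg)
  qed
  moreover have "(g has_real_derivative - 2 * f (a, b)) (at 0)"
  proof -
    have "(g has_real_derivative
        2 * x * a + 2 * y * b + ((2 * x * a * y\<^sup>2 + x\<^sup>2 * (2 * y * b)) * (x\<^sup>2 + y\<^sup>2)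
          - x\<^sup>2 * y\<^sup>2 * (2 * x * a + 2 * y * b)) / ((x\<^sup>2 + y\<^sup>2) * (x\<^sup>2 + y\<^sup>2)) - 2 * f (a, b)) (at 0)"
      unfolding g_def quartic_norm_sq_def prod.case
      using s by (auto intro!: derivative_eq_intros simp: algebra_simps)
    \<comment> \<open>The derivative of \<open>quartic_norm_sq\<close> in direction (a, b), cleared
      of its denominator, cancels once the components of the field are inserted.\<close>
    moreover have "(2 * x * a + 2 * y * b) * ((x\<^sup>2 + y\<^sup>2) * (x\<^sup>2 + y\<^sup>2)) + ((2 * x * a * y\<^sup>2 + x\<^sup>2 * (2 * y * b)) * (x\<^sup>2 + y\<^sup>2)
          - x\<^sup>2 * y\<^sup>2 * (2 * x * a + 2 * y * b)) = 0"
    proof -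
      have ab: "a = - (y * (y^4 + 2 * x\<^sup>2 * y\<^sup>2 + 2 * x^4))"
        "b = x * (x^4 + 2 * x\<^sup>2 * y\<^sup>2 + 2 * y^4)"
        using t by (simp_all add: tangent_field_def p)
      show ?thesis
        unfolding ab by algebra
    qed
    then have "2 * x * a + 2 * y * b + ((2 * x * a * y\<^sup>2 + x\<^sup>2 * (2 * y * b)) * (x\<^sup>2 + y\<^sup>2)
          - x\<^sup>2 * y\<^sup>2 * (2 * x * a + 2 * y * b)) / ((x\<^sup>2 + y\<^sup>2) * (x\<^sup>2 + y\<^sup>2)) = 0"
      using s by (simp add: add_divide_eq_iff)
    ultimately show ?thesis by simp
  qed
  ultimately have "- 2 * f (a, b) = 0"
    using g0 by (intro DERIV_local_min[of g _ 0 1]) auto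
  then show ?thesis by (simp add: t)
qed

section \<open>Homogeneous forms with explicit multilinear kernels\<close>

text \<open>
  The kernel \<open>A\<close> is required to be independent of the coordinates from \<open>k\<close> on, so that it can be
  used unchanged on tuples of every length \<open>K \<ge> k\<close>.
\<close>

definition homogeneous_form :: "nat \<Rightarrow> ('a::real_normed_vector \<Rightarrow> real) \<Rightarrow> bool" where
  "homogeneous_form k f \<longleftrightarrow> (\<exists>A.
     (\<forall>K\<ge>k. continuous_map (product_topology (\<lambda>_. euclidean) {..<K}) euclideanreal A) \<and>
     (\<forall>z i v. k \<le> i \<longrightarrow> A (z(i := v)) = A z) \<and>
     (\<forall>z i. i < k \<longrightarrow> linear (\<lambda>v. A (z(i := v)))) \<and>
     (\<forall>K\<ge>k. \<forall>x. A (restrict (\<lambda>_. x) {..<K}) = f x))"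

lemma homogeneous_form_const: "homogeneous_form 0 (\<lambda>_. c)"
  unfolding homogeneous_form_def by (intro exI[of _ "\<lambda>_. c"]) auto

lemma homogeneous_form_add:
  assumes "homogeneous_form k f" "homogeneous_form k g"
  shows "homogeneous_form k (\<lambda>x. f x + g x)"
proof -
  obtain A B where
    "\<forall>K\<ge>k. continuous_map (product_topology (\<lambda>_. euclidean) {..<K}) euclideanreal A"
    "\<forall>z i v. k \<le> i \<longrightarrow> A (z(i := v)) = A z"
    "\<forall>z i. i < k \<longrightarrow> linear (\<lambda>v. A (z(i := v)))"
    "\<forall>K\<ge>k. \<forall>x. A (restrict (\<lambda>_. x) {..<K}) = f x"
    "\<forall>K\<ge>k. continuous_map (product_topology (\<lambda>_. euclidean) {..<K}) euclideanreal B"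
    "\<forall>z i v. k \<le> i \<longrightarrow> B (z(i := v)) = B z"
    "\<forall>z i. i < k \<longrightarrow> linear (\<lambda>v. B (z(i := v)))"
    "\<forall>K\<ge>k. \<forall>x. B (restrict (\<lambda>_. x) {..<K}) = g x"
    using assms unfolding homogeneous_form_def by auto
  then show ?thesis
    unfolding homogeneous_form_def
    by (intro exI[of _ "\<lambda>z. A z + B z"]) (auto intro!: continuous_map_add linear_compose_add)
qed

text \<open>The linear factor reads the new coordinate \<open>k\<close>, on which the kernel
  \<open>A\<close> does not depend; hence the product is linear in that slot as well as in the
  earlier ones.\<close>

lemma homogeneous_form_mult_linear:
  assumes "homogeneous_form k f" and L: "bounded_linear L"
  shows "homogeneous_form (Suc k) (\<lambda>x. L x * f x)"
proof -
  obtain A where A: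
    "\<And>K. K \<ge> k \<Longrightarrow> continuous_map (product_topology (\<lambda>_. euclidean) {..<K}) euclideanreal A"
    "\<And>z i v. k \<le> i \<Longrightarrow> A (z(i := v)) = A z"
    "\<And>z i. i < k \<Longrightarrow> linear (\<lambda>v. A (z(i := v)))"
    "\<And>K x. K \<ge> k \<Longrightarrow> A (restrict (\<lambda>_. x) {..<K}) = f x"
    using assms(1) unfolding homogeneous_form_def by blast
  have lin: "linear L"
    using L by (rule bounded_linear.linear)
  show ?thesis
    unfolding homogeneous_form_def
  proof (intro exI[of _ "\<lambda>z. L (z k) * A z"] conjI allI impI)
    fix K assume K: "Suc k \<le> K"
    have "continuous_map euclidean euclideanreal L"
      using L by (simp add: linear_continuous_on)
    moreover have "continuous_map (product_topology (\<lambda>_. euclidean) {..<K}) euclidean (\<lambda>z. z k)"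
      using K by (intro continuous_map_product_projection) simp
    ultimately have "continuous_map (product_topology (\<lambda>_. euclidean) {..<K}) euclideanreal (\<lambda>z. L (z k))"
      unfolding comp_def[of L "\<lambda>z. z k", symmetric] by (rule continuous_map_compose[rotated])
    then show "continuous_map (product_topology (\<lambda>_. euclidean) {..<K}) euclideanreal (\<lambda>z. L (z k) * A z)"
      using A(1)[of K] K by (intro continuous_map_real_mult) auto
    show "L (restrict (\<lambda>_. x) {..<K} k) * A (restrict (\<lambda>_. x) {..<K}) = L x * f x" for x
      using A(4)[of K x] K by simp
  next
    fix z :: "nat \<Rightarrow> 'a" and i v assume "Suc k \<le> i"
    then show "L ((z(i := v)) k) * A (z(i := v)) = L (z k) * A z"
      using A(2)[of i z v] by simp
  next
    fix z :: "nat \<Rightarrow> 'a" and i assume i: "i < Suc k"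
    show "linear (\<lambda>v. L ((z(i := v)) k) * A (z(i := v)))"
    proof (cases "i = k")
      case True
      then show ?thesis
        using lin A(2)[of k z] by (auto simp: linear_iff algebra_simps)
    next
      case False
      then show ?thesis
        using A(3)[of i z] i by (auto simp: linear_iff algebra_simps)
    qed
  qed
qed

lemma homogeneous_form_cmult:
  assumes "homogeneous_form k f"
  shows "homogeneous_form k (\<lambda>x. c * f x)"
proof -
  obtain A where
    "\<forall>K\<ge>k. continuous_map (product_topology (\<lambda>_. euclidean) {..<K}) euclideanreal A"
    "\<forall>z i v. k \<le> i \<longrightarrow> A (z(i := v)) = A z"
    "\<forall>z i. i < k \<longrightarrow> linear (\<lambda>v. A (z(i := v)))"
    "\<forall>K\<ge>k. \<forall>x. A (restrict (\<lambda>_. x) {..<K}) = f x"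
    using assms unfolding homogeneous_form_def by auto
  then show ?thesis
    unfolding homogeneous_form_def
    by (intro exI[of _ "\<lambda>z. c * A z"])
       (auto intro!: continuous_map_real_mult_left simp: linear_iff algebra_simps)
qed

lemma homogeneous_form_mult_power:
  assumes "homogeneous_form k f" and "bounded_linear L"
  shows "homogeneous_form (n + k) (\<lambda>x. L x ^ n * f x)"
proof (induction n)
  case (Suc n)
  then show ?case
    using homogeneous_form_mult_linear[OF Suc assms(2)] by (simp add: mult.assoc)
qed (use assms(1) in simp)

text \<open>A factor x^2 + y^2 acts as the sum of two multiplications by squares of coordinate
  functionals. Such factors raise the degree 5 of \<open>tangent_field\<close> to any larger odd
  degree.\<close>

lemma homogeneous_form_mult_norm_sq_power:
  fixes f :: "real \<times> real \<Rightarrow> real"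
  assumes "homogeneous_form k f"
  shows "homogeneous_form (2 * n + k) (\<lambda>p. ((fst p)\<^sup>2 + (snd p)\<^sup>2) ^ n * f p)"
proof (induction n)
  case (Suc n)
  show ?case
    using homogeneous_form_add[OF homogeneous_form_mult_power[OF Suc bounded_linear_fst, of 2]
        homogeneous_form_mult_power[OF Suc bounded_linear_snd, of 2]]
    by (simp add: algebra_simps)
qed (use assms in simp)

lemma homogeneous_form_monomial:
  "homogeneous_form (i + j) (\<lambda>p :: real \<times> real. c * (fst p ^ i * snd p ^ j))"
  using homogeneous_form_cmult[OF homogeneous_form_mult_power[OF
      homogeneous_form_mult_power[OF homogeneous_form_const[of 1] bounded_linear_snd, of j]
      bounded_linear_fst, of i], of c] by simp

lemma homogeneous_polynomialsI:
  fixes f g :: "real \<times> real \<Rightarrow> real"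
  assumes top: "norm_topology N = euclidean" and "homogeneous_form k f" "homogeneous_form k g"
  shows "(\<lambda>p. (f p, g p)) \<in> homogeneous_polynomials k N"
proof -
  obtain A where A:
    "continuous_map (product_topology (\<lambda>_. euclidean) {..<k}) euclideanreal A"
    "\<And>z i. i < k \<Longrightarrow> linear (\<lambda>v. A (z(i := v)))"
    "\<And>x. A (restrict (\<lambda>_. x) {..<k}) = f x"
    using assms(2) unfolding homogeneous_form_def by blast
  obtain B where B:
    "continuous_map (product_topology (\<lambda>_. euclidean) {..<k}) euclideanreal B"
    "\<And>z i. i < k \<Longrightarrow> linear (\<lambda>v. B (z(i := v)))"
    "\<And>x. B (restrict (\<lambda>_. x) {..<k}) = g x"
    using assms(3) unfolding homogeneous_form_def by blast
  have "continuous_map (product_topology (\<lambda>_. euclidean) {..<k})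
      (prod_topology euclideanreal euclideanreal) (\<lambda>z. (A z, B z))"
    using A(1) B(1) by (rule continuous_map_pairedI)
  moreover have "k_linear k (\<lambda>z. (A z, B z))"
    using A(2) B(2) unfolding k_linear_def by (simp add: linear_iff)
  ultimately show ?thesis
    unfolding homogeneous_polynomials_def top using A(3) B(3)
    by (auto intro!: exI[of _ "\<lambda>z. (A z, B z)"])
qed

lemma tangent_field_homogeneous:
  assumes "norm_topology N = euclidean"
  shows "(\<lambda>p. a *\<^sub>R (((fst p)\<^sup>2 + (snd p)\<^sup>2) ^ n *\<^sub>R tangent_field p))
    \<in> homogeneous_polynomials (2 * n + 5) N"
proof -
  \<comment> \<open>Both components of \<open>tangent_field\<close> are expanded into monomials;
    exponents 0 and 1 and coefficients 1 and -1 stay written out to match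
    \<open>homogeneous_form_monomial\<close>.\<close>
  have f: "homogeneous_form 5 (\<lambda>p :: real \<times> real. -1 * (fst p ^ 0 * snd p ^ 5)
      + (-2 * (fst p ^ 2 * snd p ^ 3) + -2 * (fst p ^ 4 * snd p ^ 1)))"
    using homogeneous_form_monomial[of 0 5 "-1"] homogeneous_form_monomial[of 2 3 "-2"]
      homogeneous_form_monomial[of 4 1 "-2"] by (intro homogeneous_form_add) simp_all
  have g: "homogeneous_form 5 (\<lambda>p :: real \<times> real. 1 * (fst p ^ 5 * snd p ^ 0)
      + (2 * (fst p ^ 3 * snd p ^ 2) + 2 * (fst p ^ 1 * snd p ^ 4)))"
    using homogeneous_form_monomial[of 5 0 "1"] homogeneous_form_monomial[of 3 2 "2"]
      homogeneous_form_monomial[of 1 4 "2"] by (intro homogeneous_form_add) simp_all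
  note * = homogeneous_polynomialsI[OF assms
      homogeneous_form_cmult[OF homogeneous_form_mult_norm_sq_power[OF f, of n], of a]
      homogeneous_form_cmult[OF homogeneous_form_mult_norm_sq_power[OF g, of n], of a]]
  show ?thesis
    by (rule subst[where P = "\<lambda>P. P \<in> _", OF _ *])
       (auto simp: fun_eq_iff tangent_field_def split_beta algebra_simps power_numeral_reduce)
qed

section \<open>Powers of the norm that are not polynomials\<close>

text \<open>Doubling the argument: the polynomials r(2 t) and 2^a r(t) agree on the positive
  half-line, hence identically, and a nonzero coefficient of index n forces 2^n = 2^a.\<close>

lemma poly_eq_powr_exponent:
  fixes r :: "real poly"
  assumes eq: "\<And>t. t > 0 \<Longrightarrow> poly r t = t powr a"
  obtains n :: nat where "a = n"
proof -
  have "poly (pcompose r [:0, 2:]) t = poly (smult (2 powr a) r) t" if "t > 0" for t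
    using eq[of t] eq[of "t * 2"] that by (simp add: poly_pcompose powr_mult)
  then have "{0<..} \<subseteq> {t. poly (pcompose r [:0, 2:] - smult (2 powr a) r) t = 0}"
    by auto
  then have "pcompose r [:0, 2:] - smult (2 powr a) r = 0"
    using poly_roots_finite infinite_Ioi infinite_super by blast
  then have "2 ^ n * coeff r n = 2 powr a * coeff r n" for n
    by (metis coeff_pcompose_linear coeff_smult eq_iff_diff_eq_0)
  moreover have "r \<noteq> 0"
    using eq[of 1] by auto
  then obtain n where "coeff r n \<noteq> 0"
    by (metis leading_coeff_0_iff)
  ultimately have "2 ^ n = 2 powr a"
    by (metis mult_cancel_right)
  then have "2 powr real n = 2 powr a"
    by (simp add: powr_realpow)
  then have "a = n"
    by (subst (asm) powr_inj) auto
  then show ?thesis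
    by (rule that)
qed

text \<open>Restriction to a line leads from polynomial functions on the plane to univariate
  polynomials, where roots and divisibility are at hand.\<close>

lemma real_polynomial_function_line:
  assumes "real_polynomial_function (h :: real \<times> real \<Rightarrow> real)"
  obtains r where "\<And>t. h (a + t * b, c + t * d) = poly r t"
proof -
  have "real_polynomial_function (\<lambda>t. c + t * d)" for c d :: real
    by (intro real_polynomial_function.intros(2-3)
        real_polynomial_function.intros(1)[OF bounded_linear_mult_left])
  then have "polynomial_function (\<lambda>t::real. (a + t * b, c + t * d))"
    by (auto simp: polynomial_function_iff_Basis_inner Basis_prod_def inner_prod_def)
  from real_polynomial_function_compose[OF this assms]
  obtain e n where "h \<circ> (\<lambda>t. (a + t * b, c + t * d)) = (\<lambda>t. \<Sum>i\<le>n. e i * t ^ i)"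
    unfolding real_polynomial_function_iff_sum by blast
  then have "h (a + t * b, c + t * d) = poly (\<Sum>i\<le>n. monom (e i) i) t" for t
    by (simp add: poly_sum poly_monom fun_eq_iff)
  then show ?thesis
    using that by blast
qed

lemma quartic_norm_powr_not_polynomial:
  assumes "l > 0"
  shows "\<not> real_polynomial_function (\<lambda>p. quartic_norm p powr (2 * l))"
proof
  assume *: "real_polynomial_function (\<lambda>p. quartic_norm p powr (2 * l))"
  obtain r where r: "\<And>t. quartic_norm (0 + t * 1, 0 + t * 0) powr (2 * l) = poly r t"
    using real_polynomial_function_line[OF *, of 0 1 0 0] by blast
  have "poly r t = t powr (2 * l)" if "t > 0" for t
    using r[of t] that by (simp add: quartic_norm_def quartic_norm_sq_def)
  then obtain n where n: "2 * l = real n"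
    by (rule poly_eq_powr_exponent)
  then have "n \<noteq> 0"
    using assms by auto
  obtain r' where r': "\<And>t. quartic_norm (0 + t * 1, 1 + t * 0) powr (2 * l) = poly r' t"
    using real_polynomial_function_line[OF *, of 0 1 1 0] by blast
  define s q :: "real poly" where "s = [:1, 0, 1:]" and "q = [:1, 0, 3, 0, 1:]"
  \<comment> \<open>Squaring removes the square root in the norm even when \<open>n\<close> is
    odd.\<close>
  have "poly (r'\<^sup>2 * s ^ n) t = poly (q ^ n) t" for t
  proof -
    have pos: "1 + t\<^sup>2 > 0"
      by (simp add: add_pos_nonneg)
    have "quartic_norm (t, 1) > 0"
      using norm_le_quartic_norm[of "(t, 1)"] by (metis norm_le_zero_iff not_le order_trans prod.inject zero_neq_one zero_prod_def)
    then have "poly r' t = quartic_norm (t, 1) ^ n"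
      using r'[of t] by (simp add: n powr_realpow)
    then have "(poly r' t)\<^sup>2 = quartic_norm_sq (t, 1) ^ n"
      by (simp add: quartic_norm_def quartic_norm_sq_nonneg power_mult[symmetric] mult.commute[of n]
          flip: power_mult) (simp add: power_mult quartic_norm_sq_nonneg)
    also have "quartic_norm_sq (t, 1) = poly q t / poly s t"
      by (simp add: quartic_norm_sq_eq_quotient q_def s_def algebra_simps power_numeral_reduce)
    finally show ?thesis
      using pos by (simp add: power_divide s_def power2_eq_square)
  qed
  then have eq: "r'\<^sup>2 * s ^ n = q ^ n"
    by (metis poly_eq_poly_eq_iff ext)
  have q: "q = s * (s + 1) - 1"
    by (simp add: q_def s_def one_pCons)
  \<comment> \<open>Modulo \<open>s\<close> the polynomial \<open>q\<close> is -1, so its powers are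
    units there.\<close>
  have "\<exists>h. (s * (s + 1) - 1) ^ j = s * h + (-1) ^ j" for j
  proof (induction j)
    case (Suc j)
    then obtain h where "(s * (s + 1) - 1) ^ j = s * h + (-1) ^ j" ..
    then have "(s * (s + 1) - 1) ^ Suc j = s * ((s + 1) * (s * h + (-1) ^ j) - h) + (-1) ^ Suc j"
      by (simp add: algebra_simps)
    then show ?case ..
  qed (auto intro: exI[of _ 0])
  then obtain h where h: "q ^ n = s * h + (-1) ^ n"
    unfolding q by blast
  \<comment> \<open>As \<open>n\<close> is nonzero, the left side of \<open>eq\<close> contains a
    factor \<open>s\<close>. Together with the residue of \<open>q ^ n\<close> this would make the
    quadratic \<open>s\<close> a unit.\<close>
  have "s dvd q ^ n"
    using eq \<open>n \<noteq> 0\<close> by (metis dvd_power dvd_trans dvd_triv_right neq0_conv)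
  then have "s dvd (-1) ^ n"
    unfolding h by (simp add: dvd_add_right_iff)
  then have "s dvd 1"
    by (metis dvd_trans dvd_power_same dvd_minus_iff minus_one_power_iff dvd_refl)
  then show False
    by (simp add: s_def is_unit_iff_degree)
qed

theorem mainTheorem5:
  fixes m :: nat
  assumes "m \<ge> 3"
  shows "\<exists>N :: real \<times> real \<Rightarrow> real.
           is_norm N \<and> absolute_norm N \<and> normalized_norm N \<and> symmetric_norm N \<and>
           polynomial_numerical_index (2 * m - 1) N = 0 \<and>
           (\<forall>l::real. l > 0 \<longrightarrow> \<not> real_polynomial_function (\<lambda>p. N p powr (2 * l)))"
proof (intro exI[of _ quartic_norm] conjI allI impI)
  show "is_norm quartic_norm"
    by (rule is_norm_quartic_norm)
  show "absolute_norm quartic_norm" "normalized_norm quartic_norm" "symmetric_norm quartic_norm"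
    by (simp_all add: absolute_norm_def normalized_norm_def symmetric_norm_def quartic_norm_def
        quartic_norm_sq_def add.commute mult.commute)
  show "\<not> real_polynomial_function (\<lambda>p. quartic_norm p powr (2 * l))" if "l > 0" for l
    using that by (rule quartic_norm_powr_not_polynomial)
  define P where "P = (\<lambda>p. ((fst p)\<^sup>2 + (snd p)\<^sup>2) ^ (m - 3) *\<^sub>R tangent_field p)"
  have lower: "1 * norm v \<le> quartic_norm v" for v
    using norm_le_quartic_norm by simp
  show "polynomial_numerical_index (2 * m - 1) quartic_norm = 0"
  proof (rule polynomial_numerical_index_eq_0[where P = P and z = "(1, 0)" and c = 1])
    \<comment> \<open>The assumption on \<open>m\<close> makes the subtraction \<open>m - 3\<close>
      of natural numbers exact.\<close>
    have "2 * (m - 3) + 5 = 2 * m - 1"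
      using assms by simp
    then show "(\<lambda>x. a *\<^sub>R P x) \<in> homogeneous_polynomials (2 * m - 1) quartic_norm" for a
      using tangent_field_homogeneous[OF norm_topology_quartic_norm, of a "m - 3"] by (simp add: P_def)
    show "f (P p) = 0" if "(p, f) \<in> state_pairs quartic_norm" for p f
    proof -
      have "linear f" "f p = 1" "quartic_norm p = 1"
        using that by (auto simp: state_pairs_def dual_space_def)
      then show ?thesis
        using state_annihilates_tangent_field[OF
            state_pairs_abs_le[OF is_norm_quartic_norm zero_less_one lower that]]
        by (simp add: P_def linear_scale)
    qed
    \<comment> \<open>Here x^2 + y^2 = 1, and the value of \<open>P\<close> is (0, 1).\<close>
    show "P (1, 0) \<noteq> 0" "quartic_norm (1, 0) \<le> 1"
      by (simp_all add: P_def tangent_field_def zero_prod_def quartic_norm_def quartic_norm_sq_def)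
  qed (use lower in \<open>simp_all add: is_norm_quartic_norm continuous_on_quartic_norm
      norm_topology_quartic_norm state_pairs_quartic_norm_ne\<close>)
qed

end
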